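(* Let $N\ge 2$, $\beta>0$, and let $\xi(t)=(\xi_1(t),\dots,\xi_{N+1}(t))$, $t\in\mathbb{Z}_+$, be the growth process with neighbourhoods $U_i=\{i\}$, $i=1,\dots,N+1$ (no interaction), and let $\zeta(t)=(\zeta_1(t),\dots,\zeta_N(t))$, $\zeta_i(t)=\xi_i(t)-\xi_{N+1}(t)$, be its process of differences. (1) If $0<\beta<1$, then the Markov chain $(\zeta(t),\,t\in\mathbb{Z}_+)$ is ergodic. (2) If $\beta>1$, then the Markov chain $(\zeta(t),\,t\in\mathbb{Z}_+)$ is transient.
   Context: $\mathbb{Z}_+=\{0,1,2,\dots\}$. The sites are $1,2,\dots,N+1$ with $N\ge 2$, arranged as a one-dimensional lattice torus. To each site $i$ is attached a neighbourhood $U_i\subset\{1,\dots,N+1\}$. The growth process is the discrete-time Markov chain $\xi(t)$ on $\mathbb{Z}_+^{N+1}$ with transition probabilities $$\mathbb{P}\{\xi_i(t+1)=\xi_i(t)+1,\ \xi_j(t+1)=\xi_j(t)\ \forall j\neq i\mid \xi(t)\}=\frac{\beta^{u_i(t)}}{\sum_{j=1}^{N+1}\beta^{u_j(t)}},\qquad u_i(t)=\sum_{j\in U_i}\xi_j(t),\quad i=1,\dots,N+1,$$ where $\beta>0$ is a parameter. The process of differences $\zeta(t)\in\mathbb{Z}^N$, $\zeta_i(t)=\xi_i(t)-\xi_{N+1}(t)$, $i=1,\dots,N$ (with the convention $\zeta_{N+1}(t)\equiv 0$), is itself a time-homogeneous Markov chain on $\mathbb{Z}^N$: for $k=1,\dots,N$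 it moves from $\zeta(t)$ to $\zeta(t)+e_k$ ($e_k$ the $k$-th unit vector) with probability proportional to $\beta^{\sum_{j\in U_k}\zeta_j(t)}$, and to $\zeta(t)-(1,\dots,1)$ with probability proportional to $\beta^{\sum_{j\in U_{N+1}}\zeta_j(t)}$. "Ergodic" means positive recurrent. "Transient" means that $\lim_{t\to\infty}|\zeta(t)|=\infty$ almost surely, where $|\cdot|$ is the Euclidean norm. *)

theory Defs
  imports "HOL-Probability.Probability"
begin

definition markov_chain :: "'w measure \<Rightarrow> ('s::countable \<Rightarrow> 's pmf) \<Rightarrow> (nat \<Rightarrow> 'w \<Rightarrow> 's) \<Rightarrow> bool" where
  "markov_chain M K X \<longleftrightarrow>
     prob_space M \<and>
     (\<forall>t. X t \<in> measurable M (count_space UNIV)) \<and>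
     (\<forall>t x. \<P>(\<omega> in M. \<forall>s\<le>t. X s \<omega> = x s) > 0 \<longrightarrow>
        \<P>(\<omega> in M. X (Suc t) \<omega> = x (Suc t) \<bar> \<forall>s\<le>t. X s \<omega> = x s) = pmf (K (x t)) (x (Suc t)))"

text \<open>The law on path space of the chain with kernel \<^term>\<open>K\<close> started at \<^term>\<open>x\<close>: the Ionescu-Tulcea
  limit of the steps below, the history \<^term>\<open>h\<close> giving the states at times \<^term>\<open>{0..<n}\<close>.\<close>

definition path_step :: "('s \<Rightarrow> 's pmf) \<Rightarrow> 's \<Rightarrow> nat \<Rightarrow> (nat \<Rightarrow> 's) \<Rightarrow> 's measure" where
  "path_step K x n h = measure_pmf (case n of 0 \<Rightarrow> return_pmf x | Suc m \<Rightarrow> K (h m))"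

definition path_law :: "('s::countable \<Rightarrow> 's pmf) \<Rightarrow> 's \<Rightarrow> (nat \<Rightarrow> 's) measure" where
  "path_law K x =
     projective_family.lim UNIV (Ionescu_Tulcea.CI (path_step K x) (\<lambda>_. count_space UNIV))
       (\<lambda>_. count_space UNIV)"

lemma Ionescu_Tulcea_path_step:
  fixes K :: "'s::countable \<Rightarrow> 's pmf"
  shows "Ionescu_Tulcea (path_step K x) (\<lambda>_. count_space UNIV)"
proof (rule Ionescu_Tulcea.intro)
  fix i
  show "path_step K x i \<in> measurable (PiM {0..<i} (\<lambda>_. count_space UNIV)) (subprob_algebra (count_space UNIV))"
  proof (cases i)
    case 0
    then show ?thesis
      by (simp add: path_step_def[abs_def] measure_pmf_in_subprob_algebra)
  next
    case (Suc m)
    have eq: "path_step K x i = (\<lambda>h. measure_pmf (K (h m)))"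
      using Suc by (simp add: path_step_def[abs_def])
    have "(\<lambda>h. h m) \<in> measurable (PiM {0..<i} (\<lambda>_. count_space (UNIV :: 's set))) (count_space UNIV)"
      using Suc by (intro measurable_component_singleton) auto
    moreover have "(\<lambda>y. measure_pmf (K y)) \<in> measurable (count_space UNIV) (subprob_algebra (count_space UNIV))"
      by (simp add: measure_pmf_in_subprob_algebra)
    ultimately show ?thesis
      unfolding eq by (rule measurable_compose)
  qed
  show "prob_space (path_step K x i h)" for h
    by (simp add: path_step_def measure_pmf.prob_space_axioms)
qed

definition return_time :: "'s \<Rightarrow> (nat \<Rightarrow> 's) \<Rightarrow> enat" where
  "return_time x \<omega> = (INF n\<in>{n. n \<ge> 1 \<and> \<omega> n = x}. enat n)"

definition positive_recurrent_state :: "('s::countable \<Rightarrow> 's pmf) \<Rightarrow> 's \<Rightarrow> bool" where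
  "positive_recurrent_state K x \<longleftrightarrow>
     (\<integral>\<^sup>+ \<omega>. ennreal_of_enat (return_time x \<omega>) \<partial>path_law K x) < \<infinity>"

definition ergodic_chain :: "'w measure \<Rightarrow> ('s::countable \<Rightarrow> 's pmf) \<Rightarrow> (nat \<Rightarrow> 'w \<Rightarrow> 's) \<Rightarrow> bool" where
  "ergodic_chain M K X \<longleftrightarrow> markov_chain M K X \<and> (\<forall>x. positive_recurrent_state K x)"

definition transient_chain ::
    "'w measure \<Rightarrow> (int ^ 'n \<Rightarrow> (int ^ 'n::finite) pmf) \<Rightarrow> (nat \<Rightarrow> 'w \<Rightarrow> int ^ 'n) \<Rightarrow> bool" where
  "transient_chain M K X \<longleftrightarrow> markov_chain M K X \<and>
     (AE \<omega> in M. filterlim (\<lambda>t. norm (\<chi> i. real_of_int (X t \<omega> $ i))) at_top sequentially)"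

text \<open>The \<open>N + 1\<close> sites are the elements of \<^typ>\<open>'n option\<close> with \<open>N = CARD('n)\<close>; site \<open>N + 1\<close> is \<^term>\<open>None\<close>.\<close>

definition choose_site :: "('i::finite \<Rightarrow> real) \<Rightarrow> 'i pmf" where
  "choose_site w = embed_pmf (\<lambda>i. w i / (\<Sum>j\<in>UNIV. w j))"

lemma pmf_choose_site:
  fixes w :: "'i::finite \<Rightarrow> real"
  assumes "\<And>i. w i > 0"
  shows "pmf (choose_site w) i = w i / (\<Sum>j\<in>UNIV. w j)"
proof -
  have pos: "(\<Sum>j\<in>UNIV. w j) > 0"
    using assms by (intro sum_pos) auto
  have nn: "0 \<le> w i / (\<Sum>j\<in>UNIV. w j)" for i
    using pos assms[of i] by simp
  have "(\<integral>\<^sup>+ i. ennreal (w i / (\<Sum>j\<in>UNIV. w j)) \<partial>count_space UNIV) = ennreal (\<Sum>i\<in>UNIV. w i / (\<Sum>j\<in>UNIV. w j))"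
    using nn by (simp add: nn_integral_count_space_finite)
  also have "\<dots> = 1"
    using pos by (simp flip: sum_divide_distrib)
  finally show ?thesis
    unfolding choose_site_def by (intro pmf_embed_pmf nn)
qed

definition growth_kernel ::
    "real \<Rightarrow> ('i \<Rightarrow> 'i set) \<Rightarrow> nat ^ 'i \<Rightarrow> (nat ^ 'i::finite) pmf" where
  "growth_kernel \<beta> U x =
     map_pmf (\<lambda>i. x + axis i 1) (choose_site (\<lambda>i. \<beta> ^ (\<Sum>j\<in>U i. x $ j)))"

lemma pmf_growth_kernel:
  assumes "\<beta> > 0"
  shows "pmf (growth_kernel \<beta> U x) (x + axis i 1) =
     \<beta> ^ (\<Sum>k\<in>U i. x $ k) / (\<Sum>j\<in>UNIV. \<beta> ^ (\<Sum>k\<in>U j. x $ k))"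
proof -
  have "inj (\<lambda>i. x + axis i 1)"
    by (auto simp: inj_def axis_eq_axis)
  then show ?thesis
    unfolding growth_kernel_def
    by (subst pmf_map_inj'[where f = "\<lambda>i. x + axis i 1"]) (use assms in \<open>simp_all add: pmf_choose_site\<close>)
qed

definition growth_process ::
    "real \<Rightarrow> ('i \<Rightarrow> 'i set) \<Rightarrow> 'w measure \<Rightarrow> (nat \<Rightarrow> 'w \<Rightarrow> nat ^ 'i::finite) \<Rightarrow> bool" where
  "growth_process \<beta> U M \<xi> \<longleftrightarrow> markov_chain M (growth_kernel \<beta> U) \<xi>"

definition differences :: "(nat \<Rightarrow> 'w \<Rightarrow> nat ^ 'n option) \<Rightarrow> nat \<Rightarrow> 'w \<Rightarrow> int ^ 'n::finite" where
  "differences \<xi> t \<omega> = (\<chi> i. int (\<xi> t \<omega> $ Some i) - int (\<xi> t \<omega> $ None))"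

definition extend_zero :: "int ^ 'n \<Rightarrow> 'n::finite option \<Rightarrow> int" where
  "extend_zero z i = (case i of None \<Rightarrow> 0 | Some k \<Rightarrow> z $ k)"

definition difference_kernel ::
    "real \<Rightarrow> ('n option \<Rightarrow> 'n option set) \<Rightarrow> int ^ 'n \<Rightarrow> (int ^ 'n::finite) pmf" where
  "difference_kernel \<beta> U z =
     map_pmf (\<lambda>i. case i of None \<Rightarrow> z - vec 1 | Some k \<Rightarrow> z + axis k 1)
       (choose_site (\<lambda>i. \<beta> powi (\<Sum>j\<in>U i. extend_zero z j)))"

end

theory Submission
  imports Defs
begin

text \<open>For \<open>\<beta> < 1\<close>, the sum of the squared differences between the heights of all pairs of sites is a
  Foster-Lyapunov function: growth favours low sites, so outside a finite set it decreases in mean by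
  at least 1.

  For \<open>\<beta> > 1\<close>, a chain started at \<open>z\<close> may let the currently highest site grow forever. The \<open>k\<close>-th step
  of this kind has probability at least \<open>exp (- n \<beta>\<^sup>-\<^sup>k)\<close>, where \<open>n\<close> is the number of sites, so it happens
  with a probability bounded below by some \<open>c > 0\<close>, and then \<open>z\<close> is never visited again. Since at most
  one visit can be the last one, the expected number of visits to \<open>z\<close> is at most \<open>1 / c\<close>, and by
  Borel-Cantelli the chain eventually leaves \<open>z\<close>.\<close>

subsection \<open>Discrete Markov chains and lumping\<close>

lemma distr_countable_eq_density:
  fixes H :: "'w \<Rightarrow> 'a::countable"
  assumes [measurable]: "H \<in> measurable M (count_space UNIV)"
  shows "distr M (count_space UNIV) H =
    density (count_space UNIV) (\<lambda>l. emeasure M {\<omega> \<in> space M. H \<omega> = l})"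
proof (rule measure_eqI_countable[where A = UNIV])
  fix a :: 'a
  have "emeasure (distr M (count_space UNIV) H) {a} = emeasure M {\<omega> \<in> space M. H \<omega> = a}"
    by (auto simp: emeasure_distr intro!: arg_cong[where f = "emeasure M"])
  then show "emeasure (distr M (count_space UNIV) H) {a} =
      emeasure (density (count_space UNIV) (\<lambda>l. emeasure M {\<omega> \<in> space M. H \<omega> = l})) {a}"
    by (simp add: emeasure_density nn_integral_indicator_singleton)
qed auto

lemma nn_integral_countable_fibres:
  fixes H :: "'w \<Rightarrow> 'a::countable"
  assumes "H \<in> measurable M (count_space UNIV)"
  shows "(\<integral>\<^sup>+ \<omega>. F (H \<omega>) \<partial>M) =
    (\<integral>\<^sup>+ l. emeasure M {\<omega> \<in> space M. H \<omega> = l} * F l \<partial>count_space UNIV)"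
proof -
  have "(\<integral>\<^sup>+ \<omega>. F (H \<omega>) \<partial>M) = (\<integral>\<^sup>+ l. F l \<partial>distr M (count_space UNIV) H)"
    using assms by (subst nn_integral_distr) auto
  then show ?thesis
    unfolding distr_countable_eq_density[OF assms] by (subst (asm) nn_integral_density) auto
qed

lemma markov_chain_measurable:
  "markov_chain M K X \<Longrightarrow> X t \<in> measurable M (count_space UNIV)"
  by (simp add: markov_chain_def)

lemma markov_chain_cond_prob:
  assumes "markov_chain M K X" "\<P>(\<omega> in M. \<forall>s\<le>t. X s \<omega> = x s) > 0"
  shows "\<P>(\<omega> in M. X (Suc t) \<omega> = x (Suc t) \<bar> \<forall>s\<le>t. X s \<omega> = x s) = pmf (K (x t)) (x (Suc t))"
  using assms unfolding markov_chain_def by blast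

text \<open>Lists over a countable type form a countable type, so a whole history is again a
  discrete random variable and can be split into its fibres.\<close>

lemma measurable_history:
  fixes X :: "nat \<Rightarrow> 'w \<Rightarrow> 's::countable"
  assumes [measurable]: "\<And>t. X t \<in> measurable M (count_space UNIV)"
  shows "(\<lambda>\<omega>. map (\<lambda>s. X s \<omega>) [0..<n]) \<in> measurable M (count_space UNIV)"
proof (induction n)
  case (Suc n)
  note [measurable] = Suc
  have "(\<lambda>(l, y). l @ [y]) \<in> measurable (count_space UNIV \<Otimes>\<^sub>M count_space UNIV) (count_space (UNIV :: 's list set))"
    by (simp add: pair_measure_countable)
  then have "(\<lambda>\<omega>. case (map (\<lambda>s. X s \<omega>) [0..<n], X n \<omega>) of (l, y) \<Rightarrow> l @ [y]) \<in> measurable M (count_space UNIV)"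
    by (rule measurable_compose[rotated]) measurable
  then show ?case
    by simp
qed simp

text \<open>Product form of the Markov property: it makes sense also for histories of probability
  zero, where both sides vanish.\<close>

lemma markov_chain_emeasure_step:
  assumes mc: "markov_chain M K X"
  shows "emeasure M {\<omega> \<in> space M. (\<forall>s\<le>t. X s \<omega> = x s) \<and> X (Suc t) \<omega> = y} =
    emeasure M {\<omega> \<in> space M. \<forall>s\<le>t. X s \<omega> = x s} * pmf (K (x t)) y"
proof -
  interpret prob_space M
    using mc by (simp add: markov_chain_def)
  note [measurable] = markov_chain_measurable[OF mc]
  define E where "E = {\<omega> \<in> space M. \<forall>s\<le>t. X s \<omega> = x s}"
  define E' where "E' = {\<omega> \<in> space M. (\<forall>s\<le>t. X s \<omega> = x s) \<and> X (Suc t) \<omega> = y}"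
  have [measurable]: "E \<in> sets M" "E' \<in> sets M"
    unfolding E_def E'_def by measurable
  have "prob E' = prob E * pmf (K (x t)) y"
  proof (cases "prob E > 0")
    case True
    \<comment> \<open>\<open>markov_chain\<close> uses a single sequence for past and next state, so
      \<open>y\<close> is inserted as its entry at \<open>Suc t\<close>.\<close>
    define x' where "x' = x(Suc t := y)"
    have E_eq: "E = {\<omega> \<in> space M. \<forall>s\<le>t. X s \<omega> = x' s}"
      unfolding E_def x'_def by auto
    with True have "\<P>(\<omega> in M. X (Suc t) \<omega> = x' (Suc t) \<bar> \<forall>s\<le>t. X s \<omega> = x' s) = pmf (K (x' t)) (x' (Suc t))"
      by (intro markov_chain_cond_prob[OF mc]) simp
    then have "prob {\<omega> \<in> space M. X (Suc t) \<omega> = y \<and> (\<forall>s\<le>t. X s \<omega> = x' s)} / prob E = pmf (K (x t)) y"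
      unfolding cond_prob_def E_eq by (simp add: x'_def)
    moreover have "{\<omega> \<in> space M. X (Suc t) \<omega> = y \<and> (\<forall>s\<le>t. X s \<omega> = x' s)} = E'"
      unfolding E'_def x'_def by auto
    ultimately show ?thesis
      using True by (simp add: field_simps)
  next
    case False
    moreover have "prob E' \<le> prob E"
      by (intro finite_measure_mono) (auto simp: E_def E'_def)
    ultimately show ?thesis
      by (smt (verit) measure_nonneg mult_eq_0_iff)
  qed
  then show ?thesis
    unfolding E_def[symmetric] E'_def[symmetric] emeasure_eq_measure by (simp add: ennreal_mult)
qed

text \<open>Markov property against a functional \<open>G\<close> of the entire past, obtained by
  summing the product form over all histories and next states.\<close>

lemma markov_chain_nn_integral_step:
  fixes X :: "nat \<Rightarrow> 'w \<Rightarrow> 's::countable"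
  assumes mc: "markov_chain M K X"
  shows "(\<integral>\<^sup>+ \<omega>. G (map (\<lambda>s. X s \<omega>) [0..<Suc t]) * f (X (Suc t) \<omega>) \<partial>M) =
    (\<integral>\<^sup>+ \<omega>. G (map (\<lambda>s. X s \<omega>) [0..<Suc t]) * (\<integral>\<^sup>+ y. f y \<partial>K (X t \<omega>)) \<partial>M)"
proof -
  note [measurable] = markov_chain_measurable[OF mc]
  define H where "H \<omega> = map (\<lambda>s. X s \<omega>) [0..<Suc t]" for \<omega>
  have H [measurable]: "H \<in> measurable M (count_space UNIV)"
    unfolding H_def by (rule measurable_history) measurable
  have HX: "(\<lambda>\<omega>. (H \<omega>, X (Suc t) \<omega>)) \<in> measurable M (count_space UNIV)"
    using measurable_Pair[OF H markov_chain_measurable[OF mc, of "Suc t"]]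
    by (simp add: pair_measure_countable)
  \<comment> \<open>The last entry of a history is the state at time \<open>t\<close>; a list of any
    other length has an empty fibre, and the identity reads 0 = 0.\<close>
  have step: "emeasure M {\<omega> \<in> space M. (H \<omega>, X (Suc t) \<omega>) = (l, y)} =
      emeasure M {\<omega> \<in> space M. H \<omega> = l} * pmf (K (last l)) y" for l y
  proof (cases "length l = Suc t")
    case True
    have H_eq: "H \<omega> = l \<longleftrightarrow> (\<forall>s\<le>t. X s \<omega> = l ! s)" for \<omega>
      using True unfolding H_def list_eq_iff_nth_eq by (auto simp del: upt_Suc simp: less_Suc_eq_le)
    have "last l = l ! t"
      using True by (cases l) (auto simp: last_conv_nth)
    then show ?thesis
      using markov_chain_emeasure_step[OF mc, of t "\<lambda>s. l ! s" y] by (simp add: H_eq)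
  next
    case False
    then have "H \<omega> \<noteq> l" for \<omega>
      unfolding H_def by auto
    then show ?thesis
      by simp
  qed
  have "(\<integral>\<^sup>+ \<omega>. G (H \<omega>) * f (X (Suc t) \<omega>) \<partial>M) =
      (\<integral>\<^sup>+ \<omega>. (\<lambda>(l, y). G l * f y) (H \<omega>, X (Suc t) \<omega>) \<partial>M)"
    by simp
  also have "\<dots> = (\<integral>\<^sup>+ p. emeasure M {\<omega> \<in> space M. (H \<omega>, X (Suc t) \<omega>) = p} * (\<lambda>(l, y). G l * f y) p \<partial>count_space UNIV)"
    by (rule nn_integral_countable_fibres[OF HX])
  also have "\<dots> = (\<integral>\<^sup>+ l. \<integral>\<^sup>+ y. emeasure M {\<omega> \<in> space M. H \<omega> = l} * pmf (K (last l)) y * (G l * f y)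
      \<partial>count_space UNIV \<partial>count_space UNIV)"
    by (subst nn_integral_fst_count_space[symmetric]) (simp add: step del: prod.inject)
  also have "\<dots> = (\<integral>\<^sup>+ l. emeasure M {\<omega> \<in> space M. H \<omega> = l} * (G l * (\<integral>\<^sup>+ y. f y \<partial>K (last l))) \<partial>count_space UNIV)"
    by (intro nn_integral_cong) (simp add: nn_integral_measure_pmf nn_integral_cmult[symmetric] ac_simps)
  also have "\<dots> = (\<integral>\<^sup>+ \<omega>. G (H \<omega>) * (\<integral>\<^sup>+ y. f y \<partial>K (last (H \<omega>))) \<partial>M)"
    by (rule nn_integral_countable_fibres[OF H, symmetric])
  finally show ?thesis
    by (simp add: H_def)
qed

text \<open>A history of the image chain is a union of histories of \<open>X\<close>, all ending in
  the same fibre of \<open>D\<close>. By \<open>lump\<close> they jump to the next fibre with the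
  same probability, and this factor leaves the integral.\<close>

lemma markov_chain_lump:
  fixes X :: "nat \<Rightarrow> 'w \<Rightarrow> 's::countable" and D :: "'s \<Rightarrow> 'd::countable"
  assumes mc: "markov_chain M K X"
    and lump: "\<And>x. map_pmf D (K x) = K' (D x)"
  shows "markov_chain M K' (\<lambda>t \<omega>. D (X t \<omega>))"
  unfolding markov_chain_def
proof (intro conjI allI impI)
  show "prob_space M"
    using mc by (simp add: markov_chain_def)
  then interpret prob_space M .
  note [measurable] = markov_chain_measurable[OF mc]
  show DX [measurable]: "(\<lambda>\<omega>. D (X t \<omega>)) \<in> measurable M (count_space UNIV)" for t
    by (rule measurable_compose[OF markov_chain_measurable[OF mc]]) simp
  fix t z
  assume pos: "\<P>(\<omega> in M. \<forall>s\<le>t. D (X s \<omega>) = z s) > 0"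
  define G :: "'s list \<Rightarrow> ennreal" where "G l = (if \<forall>s\<le>t. D (l ! s) = z s then 1 else 0)" for l
  define E where "E = {\<omega> \<in> space M. \<forall>s\<le>t. D (X s \<omega>) = z s}"
  define E' where "E' = {\<omega> \<in> space M. D (X (Suc t) \<omega>) = z (Suc t) \<and> (\<forall>s\<le>t. D (X s \<omega>) = z s)}"
  have [measurable]: "E \<in> sets M" "E' \<in> sets M"
    unfolding E_def E'_def by measurable
  have G: "G (map (\<lambda>s. X s \<omega>) [0..<Suc t]) = indicator E \<omega>" if "\<omega> \<in> space M" for \<omega>
    using that unfolding G_def E_def
    by (auto simp del: upt_Suc simp: indicator_def)
  have "emeasure M E' = (\<integral>\<^sup>+ \<omega>. G (map (\<lambda>s. X s \<omega>) [0..<Suc t]) * indicator (D -` {z (Suc t)}) (X (Suc t) \<omega>) \<partial>M)"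
    by (subst nn_integral_indicator[symmetric], simp, rule nn_integral_cong)
      (auto simp del: upt_Suc simp: G E_def E'_def indicator_def)
  also have "\<dots> = (\<integral>\<^sup>+ \<omega>. G (map (\<lambda>s. X s \<omega>) [0..<Suc t]) * (\<integral>\<^sup>+ y. indicator (D -` {z (Suc t)}) y \<partial>K (X t \<omega>)) \<partial>M)"
    by (rule markov_chain_nn_integral_step[OF mc])
  also have "\<dots> = (\<integral>\<^sup>+ \<omega>. indicator E \<omega> * ennreal (pmf (K' (z t)) (z (Suc t))) \<partial>M)"
  proof (rule nn_integral_cong)
    fix \<omega> assume \<omega>: "\<omega> \<in> space M"
    have int: "(\<integral>\<^sup>+ y. indicator (D -` {z (Suc t)}) y \<partial>K (X t \<omega>)) = pmf (K' (D (X t \<omega>))) (z (Suc t))"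
      by (subst nn_integral_indicator) (simp_all add: lump[symmetric] pmf_map measure_pmf.emeasure_eq_measure)
    show "G (map (\<lambda>s. X s \<omega>) [0..<Suc t]) * (\<integral>\<^sup>+ y. indicator (D -` {z (Suc t)}) y \<partial>K (X t \<omega>)) =
        indicator E \<omega> * ennreal (pmf (K' (z t)) (z (Suc t)))"
    proof (cases "\<omega> \<in> E")
      case True
      then have "D (X t \<omega>) = z t"
        by (simp add: E_def)
      with True show ?thesis
        unfolding int G[OF \<omega>] by simp
    next
      case False
      then show ?thesis
        unfolding G[OF \<omega>] by simp
    qed
  qed
  also have "\<dots> = emeasure M E * pmf (K' (z t)) (z (Suc t))"
    by (simp add: nn_integral_multc)
  finally have "prob E' = prob E * pmf (K' (z t)) (z (Suc t))"
    by (simp add: emeasure_eq_measure flip: ennreal_mult)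
  then show "\<P>(\<omega> in M. D (X (Suc t) \<omega>) = z (Suc t) \<bar> \<forall>s\<le>t. D (X s \<omega>) = z s) = pmf (K' (z t)) (z (Suc t))"
    using pos unfolding cond_prob_def E_def[symmetric] E'_def[symmetric] by simp
qed

subsection \<open>Taboo probabilities and return times\<close>

text \<open>One-step operator of the chain killed on entering \<open>z\<close>. The starting point
  itself is not tested, so that \<open>x = z\<close> leads to the first return.\<close>

definition taboo :: "('s \<Rightarrow> 's pmf) \<Rightarrow> 's \<Rightarrow> ('s \<Rightarrow> ennreal) \<Rightarrow> 's \<Rightarrow> ennreal" where
  "taboo K z f x = (\<integral>\<^sup>+ y. (if y = z then 0 else f y) \<partial>K x)"

text \<open>Every marginal has the total mass of the limit; the one on the empty set of times will
  do.\<close>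

lemma prob_space_path_law: "prob_space (path_law K x)"
proof -
  interpret IT: Ionescu_Tulcea "path_step K x" "\<lambda>_. count_space UNIV"
    by (rule Ionescu_Tulcea_path_step)
  have "prob_space (distr IT.PF.lim (PiM {} (\<lambda>_. count_space UNIV)) (\<lambda>\<omega>. restrict \<omega> {}))"
    unfolding IT.distr_lim[OF finite.emptyI] by (rule IT.PF.prob_space_P) auto
  then show ?thesis
    unfolding path_law_def
    by (rule prob_space_distrD[rotated]) (auto simp: measurable_cong_sets[OF IT.PF.sets_lim refl])
qed

text \<open>The last coordinate is integrated out with the kernel that generates it, which reduces
  times up to \<open>n\<close> to times below \<open>n\<close>.\<close>

lemma path_law_nn_integral_step:
  fixes K :: "'s::countable \<Rightarrow> 's pmf"
  assumes [measurable]: "f \<in> borel_measurable (PiM {0..<Suc n} (\<lambda>_. count_space UNIV))"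
  shows "(\<integral>\<^sup>+ \<omega>. f (restrict \<omega> {0..<Suc n}) \<partial>path_law K x) =
    (\<integral>\<^sup>+ \<omega>. \<integral>\<^sup>+ y. f ((restrict \<omega> {0..<n})(n := y)) \<partial>path_step K x n (restrict \<omega> {0..<n}) \<partial>path_law K x)"
proof -
  interpret IT: Ionescu_Tulcea "path_step K x" "\<lambda>_. count_space UNIV"
    by (rule Ionescu_Tulcea_path_step)
  let ?N = "\<lambda>n. PiM {0..<n} (\<lambda>_. count_space (UNIV :: 's set))"
  have law: "path_law K x = IT.PF.lim"
    unfolding path_law_def ..
  \<comment> \<open>An initial segment of times is its own hull, so the projective family on it is
    the composed kernel \<open>C\<close> itself.\<close>
  have up_to: "IT.up_to {0..<m} = m" for m
    by (metis IT.up_to_iff_Ico antisym finite_atLeastLessThan order_refl IT.up_to ivl_subset le_zero_eq linorder_le_cases)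
  have CI: "IT.CI {0..<m} = IT.C 0 m (\<lambda>_. undefined)" for m
    unfolding IT.CI_def up_to using IT.distr_C[of m m "\<lambda>_. undefined" 0] by (simp add: space_PiM)
  have restr: "(\<integral>\<^sup>+ \<omega>. g (restrict \<omega> {0..<m}) \<partial>path_law K x) = (\<integral>\<^sup>+ h. g h \<partial>IT.C 0 m (\<lambda>_. undefined))"
    if [measurable]: "g \<in> borel_measurable (?N m)" for g m
    unfolding law CI[symmetric] IT.distr_lim[OF finite_atLeastLessThan, symmetric]
    by (subst nn_integral_distr) (auto simp: measurable_cong_sets[OF IT.PF.sets_lim refl])
  have "(\<integral>\<^sup>+ \<omega>. f (restrict \<omega> {0..<Suc n}) \<partial>path_law K x) = (\<integral>\<^sup>+ h. f h \<partial>IT.C 0 (Suc n) (\<lambda>_. undefined))"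
    by (rule restr) measurable
  also have "\<dots> = (\<integral>\<^sup>+ h. \<integral>\<^sup>+ h'. f h' \<partial>IT.eP n h \<partial>IT.C 0 n (\<lambda>_. undefined))"
    by (simp add: nn_integral_bind[where B = "?N (Suc n)"] measurable_cong_sets[OF IT.sets_C refl] space_PiM)
  also have "\<dots> = (\<integral>\<^sup>+ \<omega>. \<integral>\<^sup>+ h'. f h' \<partial>IT.eP n (restrict \<omega> {0..<n}) \<partial>path_law K x)"
    by (rule restr[symmetric]) measurable
  also have "\<dots> = (\<integral>\<^sup>+ \<omega>. \<integral>\<^sup>+ y. f ((restrict \<omega> {0..<n})(n := y)) \<partial>path_step K x n (restrict \<omega> {0..<n}) \<partial>path_law K x)"
    by (intro nn_integral_cong IT.nn_integral_eP) (auto simp: space_PiM)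
  finally show ?thesis .
qed

text \<open>Integrating out the last coordinate turns \<open>f\<close> into
  \<open>taboo K z f\<close>; hence the induction has to run over all \<open>f\<close>.\<close>

lemma path_law_taboo:
  fixes K :: "'s::countable \<Rightarrow> 's pmf"
  shows "(\<integral>\<^sup>+ \<omega>. (if \<forall>k\<in>{1..n}. \<omega> k \<noteq> z then f (\<omega> n) else 0) \<partial>path_law K x) = (taboo K z ^^ n) f x"
proof (induction n arbitrary: f)
  case 0
  let ?g = "\<lambda>h. f (h 0) :: ennreal"
  have [measurable]: "(\<lambda>h. h 0) \<in> measurable (PiM {0..<Suc 0} (\<lambda>_. count_space UNIV)) (count_space UNIV)"
    by (intro measurable_component_singleton) auto
  have "prob_space (path_law K x)"
    by (rule prob_space_path_law)
  then show ?case
    using path_law_nn_integral_step[of ?g 0 K x]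
    by (simp add: path_step_def prob_space.emeasure_space_1)
next
  case (Suc n)
  let ?g = "\<lambda>h. if \<forall>k\<in>{1..Suc n}. h k \<noteq> z then f (h (Suc n)) else 0"
  have [measurable]: "(\<lambda>h. h k) \<in> measurable (PiM {0..<Suc (Suc n)} (\<lambda>_. count_space UNIV)) (count_space UNIV)"
    if "k \<in> {0..Suc n}" for k
    using that by (intro measurable_component_singleton) auto
  have [measurable]: "?g \<in> borel_measurable (PiM {0..<Suc (Suc n)} (\<lambda>_. count_space UNIV))"
    by measurable
  have "(\<integral>\<^sup>+ \<omega>. ?g \<omega> \<partial>path_law K x) = (\<integral>\<^sup>+ \<omega>. ?g (restrict \<omega> {0..<Suc (Suc n)}) \<partial>path_law K x)"
    by (intro nn_integral_cong) auto
  also have "\<dots> = (\<integral>\<^sup>+ \<omega>. (if \<forall>k\<in>{1..n}. \<omega> k \<noteq> z then taboo K z f (\<omega> n) else 0) \<partial>path_law K x)"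
    unfolding path_law_nn_integral_step[OF \<open>?g \<in> _\<close>]
  proof (rule nn_integral_cong)
    fix \<omega>
    define P where "P \<longleftrightarrow> (\<forall>k\<in>{1..n}. \<omega> k \<noteq> z)"
    have int: "(\<integral>\<^sup>+ y. ?g ((restrict \<omega> {0..<Suc n})(Suc n := y)) \<partial>path_step K x (Suc n) (restrict \<omega> {0..<Suc n})) =
        (\<integral>\<^sup>+ y. (if P then (if y = z then 0 else f y) else 0) \<partial>K (\<omega> n))"
    proof -
      have "?g ((restrict \<omega> {0..<Suc n})(Suc n := y)) =
          (if P then (if y = z then 0 else f y) else 0)" for y
      proof -
        have "{1..Suc n} = insert (Suc n) {1..n}"
          by auto
        then have "(\<forall>k\<in>{1..Suc n}. ((restrict \<omega> {0..<Suc n})(Suc n := y)) k \<noteq> z) \<longleftrightarrow>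
            P \<and> y \<noteq> z"
          by (auto simp: P_def)
        then show ?thesis
          by simp
      qed
      then show ?thesis
        by (simp add: path_step_def)
    qed
    show "(\<integral>\<^sup>+ y. ?g ((restrict \<omega> {0..<Suc n})(Suc n := y)) \<partial>path_step K x (Suc n) (restrict \<omega> {0..<Suc n})) =
        (if \<forall>k\<in>{1..n}. \<omega> k \<noteq> z then taboo K z f (\<omega> n) else 0)"
      unfolding int P_def[symmetric] taboo_def by (cases P) simp_all
  qed
  also have "\<dots> = (taboo K z ^^ Suc n) f x"
    unfolding Suc.IH by (simp add: funpow_swap1)
  finally show ?case .
qed

lemma sets_path_law: "sets (path_law K x) = sets (PiM UNIV (\<lambda>_. count_space UNIV))"
proof -
  interpret IT: Ionescu_Tulcea "path_step K x" "\<lambda>_. count_space UNIV"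
    by (rule Ionescu_Tulcea_path_step)
  show ?thesis
    unfolding path_law_def by (rule IT.PF.sets_lim)
qed

text \<open>The strict bound becomes a non-strict one at the next integer, so that the infimum, also
  of the empty set, is tested element by element.\<close>

lemma return_time_gt: "enat t < return_time x \<omega> \<longleftrightarrow> (\<forall>k\<in>{1..t}. \<omega> k \<noteq> x)"
  unfolding return_time_def Suc_ile_eq[symmetric] le_INF_iff
  by (auto simp: not_less_eq_eq)

text \<open>Tail formula: the mean of an extended natural number is the sum over \<open>n\<close> of
  the probabilities of exceeding \<open>n\<close>.\<close>

lemma nn_integral_return_time:
  fixes K :: "'s::countable \<Rightarrow> 's pmf"
  shows "(\<integral>\<^sup>+ \<omega>. ennreal_of_enat (return_time z \<omega>) \<partial>path_law K x) = (\<Sum>n. (taboo K z ^^ n) (\<lambda>_. 1) x)"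
proof -
  note [measurable_cong] = sets_path_law[of K x]
  have [measurable]: "(\<lambda>\<omega>. \<omega> k) \<in> measurable (path_law K x) (count_space UNIV)" for k
    unfolding measurable_cong_sets[OF sets_path_law refl] by (rule measurable_component_singleton) simp
  have gt [measurable]: "{\<omega> \<in> space (path_law K x). enat t < return_time z \<omega>} \<in> sets (path_law K x)" for t
    unfolding return_time_gt by measurable
  have tail: "emeasure (path_law K x) {\<omega> \<in> space (path_law K x). enat t < return_time z \<omega>} =
      (taboo K z ^^ t) (\<lambda>_. 1) x" for t
    unfolding path_law_taboo[symmetric]
    by (subst nn_integral_indicator[OF gt, symmetric], rule nn_integral_cong)
      (auto simp: return_time_gt indicator_def)
  have "return_time z \<in> measurable (path_law K x) (count_space UNIV)"
  proof (subst measurable_count_space_eq2_countable, safe)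
    fix a :: enat
    \<comment> \<open>An extended natural number is determined by the finite numbers below it, so
      level sets come from countably many tail events.\<close>
    have "b = a" if "\<forall>t. enat t < b \<longleftrightarrow> enat t < a" for b
      using that by (cases a; cases b) (auto intro: antisym simp: not_le[symmetric])
    then have "return_time z -` {a} \<inter> space (path_law K x) =
        {\<omega> \<in> space (path_law K x). \<forall>t. enat t < return_time z \<omega> \<longleftrightarrow> enat t < a}"
      by auto
    also have "\<dots> \<in> sets (path_law K x)"
      by measurable
    finally show "return_time z -` {a} \<inter> space (path_law K x) \<in> sets (path_law K x)" .
  qed auto
  then have "(\<integral>\<^sup>+ \<omega>. ennreal_of_enat (return_time z \<omega>) \<partial>path_law K x) =
      (\<Sum>t. emeasure (path_law K x) {\<omega> \<in> space (path_law K x). enat t < return_time z \<omega>})"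
    by (rule nn_integral_enat_function)
  then show ?thesis
    unfolding tail .
qed

text \<open>By \<open>path_law_taboo\<close>, the probability that the chain from \<open>x\<close>
  is not in \<open>z\<close> at any of the times 1 to \<open>n\<close>.\<close>

abbreviation avoid :: "('s \<Rightarrow> 's pmf) \<Rightarrow> 's \<Rightarrow> nat \<Rightarrow> 's \<Rightarrow> ennreal" where
  "avoid K z n \<equiv> (taboo K z ^^ n) (\<lambda>_. 1)"

lemma taboo_mono: "(\<And>y. f y \<le> g y) \<Longrightarrow> taboo K z f x \<le> taboo K z g x"
  unfolding taboo_def by (intro nn_integral_mono) auto

lemma taboo_add: "taboo K z (\<lambda>y. f y + g y) x = taboo K z f x + taboo K z g x"
  unfolding taboo_def by (subst nn_integral_add[symmetric]) (auto intro!: nn_integral_cong)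

lemma taboo_cmult: "taboo K z (\<lambda>y. c * f y) x = c * taboo K z f x"
  unfolding taboo_def by (subst nn_integral_cmult[symmetric]) (auto intro!: nn_integral_cong)

lemma taboo_sum: "taboo K z (\<lambda>y. \<Sum>i\<in>I. f i y) x = (\<Sum>i\<in>I. taboo K z (f i) x)"
proof (induction I rule: infinite_finite_induct)
  case (insert i I)
  then show ?case
    by (simp add: taboo_add)
qed (simp_all add: taboo_def cong: if_cong)

lemma taboo_le_nn_integral: "taboo K z f x \<le> (\<integral>\<^sup>+ y. f y \<partial>K x)"
  unfolding taboo_def by (intro nn_integral_mono) auto

lemma avoid_le_1: "avoid K z n x \<le> 1"
proof (induction n arbitrary: x)
  case (Suc n)
  have "avoid K z (Suc n) x \<le> taboo K z (\<lambda>_. 1) x"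
    unfolding funpow.simps comp_def by (intro taboo_mono Suc)
  also have "\<dots> \<le> 1"
    using taboo_le_nn_integral[of K z "\<lambda>_. 1" x] by simp
  finally show ?case .
qed simp

lemma avoid_antimono: "m \<le> n \<Longrightarrow> avoid K z n x \<le> avoid K z m x"
proof (induction m arbitrary: n x)
  case 0
  then show ?case
    using avoid_le_1[of n K z x] by simp
next
  case (Suc m)
  then obtain k where "n = Suc k" "m \<le> k"
    by (cases n) auto
  then show ?case
    unfolding \<open>n = Suc k\<close> funpow.simps comp_def by (intro taboo_mono Suc.IH)
qed

text \<open>A mean of values at most 1 is below 1 as soon as some value of positive weight is below
  1.\<close>

lemma avoid_less_1_step:
  assumes "y \<in> set_pmf (K x)" and "y = z \<or> avoid K z m y < 1"
  shows "avoid K z (Suc m) x < 1"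
proof -
  define g where "g y = (if y = z then 0 else avoid K z m y)" for y
  have g_le: "g y \<le> 1" for y
    using avoid_le_1[of m K z y] by (simp add: g_def)
  have g: "g y + (1 - g y) = 1" for y
    using g_le by (rule add_diff_inverse_ennreal)
  \<comment> \<open>The complement \<open>1 - g\<close> is integrated alongside \<open>g\<close>, so
    that strictness follows by cancelling the finite value 1 in a sum.\<close>
  have "(\<integral>\<^sup>+ y. g y \<partial>K x) + (\<integral>\<^sup>+ y. 1 - g y \<partial>K x) = (\<integral>\<^sup>+ y. g y + (1 - g y) \<partial>K x)"
    by (rule nn_integral_add[symmetric]) auto
  also have "\<dots> = 1"
    unfolding g by simp
  finally have sum: "(\<integral>\<^sup>+ y. g y \<partial>K x) + (\<integral>\<^sup>+ y. 1 - g y \<partial>K x) = 1" .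
  have "(\<integral>\<^sup>+ y. 1 - g y \<partial>K x) \<noteq> 0"
  proof -
    have "1 - g y \<noteq> 0"
      using assms(2) by (auto simp: g_def diff_eq_0_iff_ennreal)
    then show ?thesis
      using assms(1) by (auto simp: nn_integral_0_iff_AE AE_measure_pmf_iff)
  qed
  then have "(\<integral>\<^sup>+ y. g y \<partial>K x) \<noteq> 1"
    using sum ennreal_add_left_cancel[of 1 "\<integral>\<^sup>+ y. 1 - g y \<partial>K x" 0] by auto
  moreover have "avoid K z (Suc m) x = (\<integral>\<^sup>+ y. g y \<partial>K x)"
    by (simp add: taboo_def g_def)
  ultimately show ?thesis
    using avoid_le_1[of "Suc m" K z x] by simp
qed

subsection \<open>Foster's criterion\<close>

text \<open>With \<open>S\<close> the sum of the first \<open>m\<close> taboo probabilities, \<open>V + B S\<close> is a Lyapunov function for the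
  chain killed at \<open>z\<close> that decreases everywhere: the decrease of \<open>S\<close> on \<open>F\<close> compensates the possible
  increase of \<open>V\<close> there.\<close>

theorem foster_positive_recurrent:
  fixes V :: "'s::countable \<Rightarrow> ennreal" and K :: "'s \<Rightarrow> 's pmf"
  assumes drift: "\<And>x. (\<integral>\<^sup>+ y. V y \<partial>K x) + 1 \<le> V x + (if x \<in> F then C else 0)"
    and fin: "finite F" "C \<noteq> \<top>" "\<And>x. V x \<noteq> \<top>"
    and reach: "\<And>x. x \<in> F \<Longrightarrow> \<exists>m. avoid K z m x < 1"
  shows "positive_recurrent_state K z"
proof -
  from reach obtain m' where m': "\<And>x. x \<in> F \<Longrightarrow> avoid K z (m' x) x < 1"
    by metis
  \<comment> \<open>\<open>avoid\<close> decreases in the horizon and \<open>F\<close> is finite, so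
    one horizon serves all of \<open>F\<close>.\<close>
  define m where "m = (\<Sum>x\<in>F. m' x)"
  have m: "avoid K z m x < 1" if "x \<in> F" for x
  proof -
    have "m' x \<le> m"
      unfolding m_def using fin(1) that by (intro member_le_sum) auto
    from avoid_antimono[OF this, of K z x] m'[OF that] show ?thesis
      by (rule order.strict_trans1)
  qed
  \<comment> \<open>\<open>S x\<close> is the mean of the first positive hitting time of
    \<open>z\<close>, truncated at \<open>m\<close>.\<close>
  define S where "S x = (\<Sum>k<m. avoid K z k x)" for x
  \<comment> \<open>\<open>taboo\<close> shifts the sum by one index: the term 1 at
    \<open>k = 0\<close> is lost and \<open>avoid K z m x\<close> is gained.\<close>
  have S_step: "taboo K z S x + 1 = S x + avoid K z m x" for x
  proof -
    have "taboo K z S x = (\<Sum>k<m. avoid K z (Suc k) x)"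
      unfolding S_def by (subst taboo_sum) simp
    then have "taboo K z S x + 1 = (\<Sum>k<Suc m. avoid K z k x)"
      by (subst sum.lessThan_Suc_shift) (simp add: add.commute)
    then show ?thesis
      by (simp add: S_def)
  qed
  have S_fin: "S x \<noteq> \<top>" for x
  proof -
    have "S x \<le> (\<Sum>k<m. 1)"
      unfolding S_def by (intro sum_mono avoid_le_1)
    then show ?thesis
      by (auto simp: top_unique)
  qed
  define \<delta> where "\<delta> x = 1 - avoid K z m x" for x
  have \<delta>: "avoid K z m x + \<delta> x = 1" for x
    unfolding \<delta>_def using avoid_le_1[of m K z x] by (simp add: add_diff_inverse_ennreal)
  have \<delta>_pos: "\<delta> x \<noteq> 0" if "x \<in> F" for x
    using m[OF that] unfolding \<delta>_def by (auto simp: diff_eq_0_iff_ennreal)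
  have \<delta>_fin: "\<delta> x \<noteq> \<top>" for x
    unfolding \<delta>_def by simp
  have S_desc: "taboo K z S x + \<delta> x = S x" for x
  proof -
    have "avoid K z m x + (taboo K z S x + \<delta> x) = taboo K z S x + (avoid K z m x + \<delta> x)"
      by (rule add.left_commute)
    also have "\<dots> = avoid K z m x + S x"
      unfolding \<delta> S_step by (rule add.commute)
    finally have "avoid K z m x + (taboo K z S x + \<delta> x) = avoid K z m x + S x" .
    moreover have "avoid K z m x \<noteq> \<top>"
      using avoid_le_1[of m K z x] by (auto simp: top_unique)
    ultimately show ?thesis
      by (simp add: ennreal_add_left_cancel)
  qed
  \<comment> \<open>All that matters is finiteness and \<open>C \<le> B * \<delta> x\<close> on
    \<open>F\<close>; a sum over \<open>F\<close> serves in place of a maximum.\<close>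
  define B where "B = (\<Sum>x\<in>F. C / \<delta> x)"
  have B_fin: "B \<noteq> \<top>"
    unfolding B_def using fin \<delta>_pos by (auto simp: ennreal_divide_eq_top_iff)
  have B: "C \<le> B * \<delta> x" if "x \<in> F" for x
  proof -
    have "C = C / \<delta> x * \<delta> x"
      using \<delta>_pos[OF that] \<delta>_fin[of x]
      by (metis ennreal_divide_times ennreal_times_divide mult.commute mult_divide_eq_ennreal)
    also have "\<dots> \<le> B * \<delta> x"
      unfolding B_def using fin(1) that by (intro mult_right_mono member_le_sum) auto
    finally show ?thesis .
  qed
  define W where "W x = V x + B * S x" for x
  have W_step: "taboo K z W x + 1 \<le> W x" for x
  proof -
    have "taboo K z W x + 1 = (taboo K z V x + 1) + B * taboo K z S x"
      unfolding W_def by (simp add: taboo_add taboo_cmult ac_simps)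
    also have "\<dots> \<le> (V x + (if x \<in> F then C else 0)) + B * taboo K z S x"
      by (intro add_mono order.trans[OF _ drift] taboo_le_nn_integral) auto
    also have "\<dots> \<le> (V x + B * \<delta> x) + B * taboo K z S x"
      using B[of x] by (intro add_mono) auto
    also have "\<dots> = V x + B * (taboo K z S x + \<delta> x)"
      by (simp add: distrib_left ac_simps)
    also have "\<dots> = W x"
      by (simp add: S_desc W_def)
    finally show ?thesis .
  qed
  \<comment> \<open>Iterating \<open>W_step\<close>, every partial sum of the tail formula stays
    below \<open>W\<close>.\<close>
  have partial: "(\<Sum>k<n. avoid K z k x) \<le> W x" for n x
  proof (induction n arbitrary: x)
    case (Suc n)
    have "(\<Sum>k<Suc n. avoid K z k x) = taboo K z (\<lambda>y. \<Sum>k<n. avoid K z k y) x + 1"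
      by (subst sum.lessThan_Suc_shift) (simp add: taboo_sum add.commute)
    also have "\<dots> \<le> taboo K z W x + 1"
      by (intro add_mono taboo_mono Suc) simp
    finally show ?case
      using W_step[of x] by (rule order.trans)
  qed simp
  have "(\<Sum>n. avoid K z n z) \<le> W z"
    by (rule suminf_le_const) (auto intro: partial)
  moreover have "W z < \<top>"
    unfolding W_def using fin(3)[of z] B_fin S_fin[of z]
    by (simp add: less_top[symmetric] ennreal_mult_eq_top_iff)
  ultimately show ?thesis
    unfolding positive_recurrent_state_def nn_integral_return_time by simp
qed

subsection \<open>Last exits\<close>

text \<open>Transition operator; its \<open>t\<close>-th iterate on \<open>indicator {z}\<close> is
  the \<open>t\<close>-step transition probability to \<open>z\<close>.\<close>

definition kernel_op :: "('s \<Rightarrow> 's pmf) \<Rightarrow> ('s \<Rightarrow> ennreal) \<Rightarrow> 's \<Rightarrow> ennreal" where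
  "kernel_op K f x = (\<integral>\<^sup>+ y. f y \<partial>K x)"

lemma markov_chain_nn_integral_marginal:
  assumes mc: "markov_chain M K X"
  shows "(\<integral>\<^sup>+ \<omega>. f (X t \<omega>) \<partial>M) = (\<integral>\<^sup>+ \<omega>. (kernel_op K ^^ t) f (X 0 \<omega>) \<partial>M)"
proof (induction t arbitrary: f)
  case (Suc t)
  have "(\<integral>\<^sup>+ \<omega>. f (X (Suc t) \<omega>) \<partial>M) = (\<integral>\<^sup>+ \<omega>. kernel_op K f (X t \<omega>) \<partial>M)"
    using markov_chain_nn_integral_step[OF mc, of "\<lambda>_. 1" t f] by (simp add: kernel_op_def)
  then show ?case
    by (simp only: Suc.IH funpow_Suc_right comp_apply)
qed simp

text \<open>The terms of the sum are the probabilities that the last visit to \<open>z\<close> up to time \<open>T\<close> happens at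
  time \<open>t\<close>; the remaining term is the probability that there is no visit.\<close>

lemma last_exit_decomposition:
  "(\<Sum>t\<le>T. (kernel_op K ^^ t) (indicator {z}) x * avoid K z (T - t) z) + (if x = z then 0 else avoid K z T x) = 1"
proof (induction T arbitrary: x)
  case (Suc T)
  let ?g = "\<lambda>t. (kernel_op K ^^ t) (indicator {z})"
  let ?v = "\<lambda>x. \<Sum>t\<le>T. ?g t x * avoid K z (T - t) z"
  \<comment> \<open>Conditioning on the first step: a last visit at \<open>Suc t\<close> within
    horizon \<open>Suc T\<close> is one at \<open>t\<close> within \<open>T\<close> for the chain
    from \<open>y\<close>.\<close>
  have shift: "(\<Sum>t\<le>T. ?g (Suc t) x * avoid K z (T - t) z) = (\<integral>\<^sup>+ y. ?v y \<partial>K x)"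
    by (simp add: kernel_op_def nn_integral_sum nn_integral_multc)
  \<comment> \<open>Exactly one of the term for \<open>t = 0\<close> and the no-visit term survives,
    and either way it equals \<open>avoid K z (Suc T) x\<close>.\<close>
  have "(\<Sum>t\<le>Suc T. ?g t x * avoid K z (Suc T - t) z) + (if x = z then 0 else avoid K z (Suc T) x) =
      avoid K z (Suc T) x + (\<integral>\<^sup>+ y. ?v y \<partial>K x)"
    unfolding sum.atMost_Suc_shift diff_Suc_Suc shift
    by (cases "x = z") (simp_all add: add.commute del: funpow.simps(2))
  also have "\<dots> = (\<integral>\<^sup>+ y. ?v y + (if y = z then 0 else avoid K z T y) \<partial>K x)"
    by (simp add: taboo_def nn_integral_add add.commute)
  finally show ?case
    unfolding Suc by simp
qed simp

text \<open>Every factor \<open>avoid\<close> in the last exit decomposition is at least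
  \<open>c\<close>, so the mean number of visits is at most \<open>1 / c\<close> from any starting
  point.\<close>

lemma markov_chain_eventually_leaves:
  fixes X :: "nat \<Rightarrow> 'w \<Rightarrow> 's::countable"
  assumes mc: "markov_chain M K X" and c: "c > 0" "\<And>n. ennreal c \<le> avoid K z n z"
  shows "AE \<omega> in M. \<forall>\<^sub>F t in sequentially. X t \<omega> \<noteq> z"
proof -
  interpret prob_space M
    using mc by (simp add: markov_chain_def)
  note [measurable] = markov_chain_measurable[OF mc]
  let ?g = "\<lambda>t. (kernel_op K ^^ t) (indicator {z})"
  define A where "A t = {\<omega> \<in> space M. X t \<omega> = z}" for t
  have [measurable]: "A t \<in> sets M" for t
    unfolding A_def by measurable
  have A: "emeasure M (A t) = (\<integral>\<^sup>+ \<omega>. ?g t (X 0 \<omega>) \<partial>M)" for t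
    unfolding markov_chain_nn_integral_marginal[OF mc, symmetric]
    by (subst nn_integral_indicator[symmetric], simp, rule nn_integral_cong) (auto simp: A_def indicator_def)
  have bound: "(\<Sum>t\<le>T. ?g t x) * ennreal c \<le> 1" for T x
  proof -
    have "(\<Sum>t\<le>T. ?g t x) * ennreal c \<le> (\<Sum>t\<le>T. ?g t x * avoid K z (T - t) z)"
      unfolding sum_distrib_right by (intro sum_mono mult_left_mono c) auto
    also have "\<dots> \<le> \<dots> + (if x = z then 0 else avoid K z T x)"
      by simp
    also have "\<dots> = 1"
      by (rule last_exit_decomposition)
    finally show ?thesis .
  qed
  have "(\<Sum>t\<le>T. prob (A t)) \<le> 1 / c" for T
  proof -
    have "ennreal ((\<Sum>t\<le>T. prob (A t)) * c) = (\<Sum>t\<le>T. emeasure M (A t)) * ennreal c"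
      using c(1) by (simp add: ennreal_mult emeasure_eq_measure sum_nonneg)
    also have "\<dots> = (\<integral>\<^sup>+ \<omega>. (\<Sum>t\<le>T. ?g t (X 0 \<omega>)) * ennreal c \<partial>M)"
      by (simp add: A nn_integral_sum nn_integral_multc)
    also have "\<dots> \<le> (\<integral>\<^sup>+ \<omega>. 1 \<partial>M)"
      by (intro nn_integral_mono bound)
    also have "\<dots> = ennreal 1"
      by (simp add: emeasure_space_1)
    finally show ?thesis
      using c(1) by (simp add: field_simps)
  qed
  then have "summable (\<lambda>t. prob (A t))"
    by (intro bounded_imp_summable) auto
  then have "AE \<omega> in M. \<forall>\<^sub>F t in sequentially. \<omega> \<in> space M - A t"
    by (intro borel_cantelli_AE1) (auto simp: emeasure_eq_measure)
  then show ?thesis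
    by (auto simp: A_def elim!: AE_mp eventually_mono)
qed

subsection \<open>The difference chain without interaction\<close>

lemma finite_int_vec_box: "finite {z :: int ^ 'n::finite. \<forall>i. z $ i \<in> {a..b}}"
proof (rule finite_subset)
  show "{z :: int ^ 'n. \<forall>i. z $ i \<in> {a..b}} \<subseteq> vec_lambda ` (PiE UNIV (\<lambda>_. {a..b}))"
  proof
    fix z :: "int ^ 'n"
    assume "z \<in> {z. \<forall>i. z $ i \<in> {a..b}}"
    then show "z \<in> vec_lambda ` (PiE UNIV (\<lambda>_. {a..b}))"
      by (intro image_eqI[of _ _ "vec_nth z"]) auto
  qed
  show "finite (vec_lambda ` (PiE (UNIV :: 'n set) (\<lambda>_. {a..b})))"
    by (intro finite_imageI finite_PiE) auto
qed

text \<open>A bounded set contains only finitely many lattice points, and each of them is eventually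
  left for good.\<close>

lemma filterlim_norm_int_vec:
  fixes x :: "nat \<Rightarrow> int ^ 'n::finite"
  assumes "\<And>z. \<forall>\<^sub>F t in sequentially. x t \<noteq> z"
  shows "filterlim (\<lambda>t. norm (\<chi> i. real_of_int (x t $ i))) at_top sequentially"
  unfolding filterlim_at_top
proof
  fix Z :: real
  define S where "S = {z :: int ^ 'n. \<forall>i. z $ i \<in> {-\<lceil>Z\<rceil>..\<lceil>Z\<rceil>}}"
  have "finite S"
    unfolding S_def by (rule finite_int_vec_box)
  then have "\<forall>\<^sub>F t in sequentially. \<forall>z\<in>S. x t \<noteq> z"
    using assms by (intro eventually_ball_finite) auto
  then show "\<forall>\<^sub>F t in sequentially. Z \<le> norm (\<chi> i. real_of_int (x t $ i))"
  proof eventually_elim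
    case (elim t)
    then have "x t \<notin> S"
      by auto
    then obtain i where i: "x t $ i \<notin> {-\<lceil>Z\<rceil>..\<lceil>Z\<rceil>}"
      by (auto simp: S_def)
    have "Z \<le> \<bar>real_of_int (x t $ i)\<bar>"
      using i by (auto simp: abs_if) linarith+
    also have "\<dots> \<le> norm (\<chi> i. real_of_int (x t $ i))"
      using component_le_norm_cart[of "\<chi> i. real_of_int (x t $ i)" i] by simp
    finally show ?case .
  qed
qed

definition grow_at :: "int ^ 'n \<Rightarrow> 'n::finite option \<Rightarrow> int ^ 'n" where
  "grow_at z i = (case i of None \<Rightarrow> z - vec 1 | Some k \<Rightarrow> z + axis k 1)"

text \<open>The last term does not depend on \<open>j\<close>: growth at \<open>None\<close> raises
  that site and then shifts all heights to restore its 0. Height differences between sites thus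
  change as in the growth process.\<close>

lemma extend_zero_grow_at:
  "extend_zero (grow_at z i) j = extend_zero z j + (if j = i then 1 else 0) - (if i = None then 1 else 0)"
  by (auto simp: extend_zero_def grow_at_def axis_def split: option.splits)

definition site_prob :: "real \<Rightarrow> int ^ 'n \<Rightarrow> 'n::finite option \<Rightarrow> real" where
  "site_prob \<beta> z i = \<beta> powi extend_zero z i / (\<Sum>j\<in>UNIV. \<beta> powi extend_zero z j)"

context
  fixes \<beta> n :: real and K :: "int ^ 'n \<Rightarrow> (int ^ 'n::finite) pmf"
  defines "K \<equiv> difference_kernel \<beta> (\<lambda>i. {i})" and "n \<equiv> real CARD('n option)"
  assumes \<beta>: "\<beta> > 0"
begin

lemma weight_sum_pos: "(\<Sum>j\<in>UNIV. \<beta> powi extend_zero z (j :: 'n option)) > 0"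
  using \<beta> by (intro sum_pos) auto

lemma site_prob_pos: "site_prob \<beta> (z :: int ^ 'n) i > 0"
  unfolding site_prob_def using weight_sum_pos \<beta> by (intro divide_pos_pos) auto

lemma sum_site_prob: "(\<Sum>i\<in>UNIV. site_prob \<beta> (z :: int ^ 'n) i) = 1"
  unfolding site_prob_def sum_divide_distrib[symmetric] using weight_sum_pos[of z] by simp

lemma difference_kernel_eq:
  "K z = map_pmf (grow_at z) (choose_site (\<lambda>i. \<beta> powi extend_zero z i))"
  unfolding K_def difference_kernel_def grow_at_def by simp

lemma pmf_choose_site_eq: "pmf (choose_site (\<lambda>i. \<beta> powi extend_zero z i)) i = site_prob \<beta> (z :: int ^ 'n) i"
  unfolding site_prob_def using \<beta> by (intro pmf_choose_site) simp

lemma nn_integral_difference_kernel: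
  "(\<integral>\<^sup>+ y. f y \<partial>K z) = (\<Sum>i\<in>UNIV. ennreal (site_prob \<beta> z i) * f (grow_at z i))"
  unfolding difference_kernel_eq nn_integral_map_pmf
  unfolding nn_integral_measure_pmf
  by (simp add: nn_integral_count_space_finite pmf_choose_site_eq)

lemma grow_at_in_set_pmf: "grow_at z i \<in> set_pmf (K z)"
  unfolding difference_kernel_eq
  using site_prob_pos[of z i] by (auto simp: set_pmf_iff pmf_choose_site_eq)

section \<open>Reachability of every state\<close>

text \<open>From \<open>x\<close>, the sites other than \<open>None\<close> grow one at a time up to
  \<open>z\<close> plus a positive constant vector; growth at \<open>None\<close> then lowers all
  coordinates together down to \<open>z\<close>.\<close>

lemma hits_in_finite_time: "\<exists>m. avoid K z m x < 1"
proof -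
  define reach where "reach x \<longleftrightarrow> (\<exists>m. avoid K z m x < 1)" for x
  have step: "reach x" if "grow_at x i = z \<or> reach (grow_at x i)" for x i
  proof -
    obtain m where "grow_at x i = z \<or> avoid K z m (grow_at x i) < 1"
      using \<open>_ \<or> reach _\<close> unfolding reach_def by auto
    then have "avoid K z (Suc m) x < 1"
      by (rule avoid_less_1_step[OF grow_at_in_set_pmf])
    then show ?thesis
      unfolding reach_def by (rule exI)
  qed
  \<comment> \<open>The offset starts at 1 because \<open>avoid\<close> counts hits only from time 1
    on.\<close>
  have diag: "reach (z + vec (1 + int c))" for c
  proof (induction c)
    case 0
    have "grow_at (z + vec (1 + int 0)) None = z"
      by (simp add: grow_at_def)
    then show ?case
      by (intro step[of _ None]) simp
  next
    case (Suc c)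
    have "grow_at (z + vec (1 + int (Suc c))) None = z + vec (1 + int c)"
      by (simp add: grow_at_def vec_eq_iff)
    with Suc show ?case
      by (intro step[of _ None]) simp
  qed
  \<comment> \<open>\<open>d\<close> counts the unit growths still missing between \<open>x\<close>
    and \<open>y\<close>.\<close>
  have below: "reach x"
    if "reach y" "\<And>k. x $ k \<le> y $ k" "(\<Sum>k\<in>UNIV. nat (y $ k - x $ k)) = d" for x y d
    using that
  proof (induction d arbitrary: x)
    case 0
    then have "x = y"
      by (auto simp: vec_eq_iff intro!: antisym)
    with 0 show ?case
      by simp
  next
    case (Suc d)
    obtain k where k: "x $ k < y $ k"
    proof (rule ccontr)
      assume "\<not> thesis"
      then have "nat (y $ k - x $ k) = 0" for k
        using that[of k] by (cases "x $ k < y $ k") auto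
      with Suc.prems(3) show False
        by simp
    qed
    have "(\<Sum>l\<in>UNIV. nat (y $ l - x $ l)) = (\<Sum>l\<in>UNIV. nat (y $ l - grow_at x (Some k) $ l) + (if l = k then 1 else 0))"
      using k by (intro sum.cong) (auto simp: grow_at_def axis_def)
    then have "(\<Sum>l\<in>UNIV. nat (y $ l - grow_at x (Some k) $ l)) = d"
      using Suc.prems(3) by (simp add: sum.distrib)
    moreover have "grow_at x (Some k) $ l \<le> y $ l" for l
      using k Suc.prems(2)[of l] by (auto simp: grow_at_def axis_def)
    ultimately have "reach (grow_at x (Some k))"
      using Suc.IH Suc.prems(1) by blast
    then show ?case
      by (intro step[of _ "Some k"]) blast
  qed
  \<comment> \<open>\<open>c\<close> dominates every coordinate of \<open>x - z\<close>, so
    \<open>x\<close> lies below a point of the diagonal through \<open>z\<close>.\<close>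
  define c where "c = nat (\<Sum>k\<in>UNIV. \<bar>x $ k - z $ k\<bar>)"
  have "x $ k \<le> (z + vec (1 + int c)) $ k" for k
  proof -
    have "\<bar>x $ k - z $ k\<bar> \<le> (\<Sum>k\<in>UNIV. \<bar>x $ k - z $ k\<bar>)"
      by (intro member_le_sum) auto
    then show ?thesis
      by (simp add: c_def)
  qed
  from below[OF diag this refl] show ?thesis
    unfolding reach_def .
qed

section \<open>The quadratic Lyapunov function for \<beta> < 1\<close>

lemma argmin_site:
  obtains i0 where "\<And>j. extend_zero z i0 \<le> extend_zero (z :: int ^ 'n) j"
proof -
  have "Min (range (extend_zero z)) \<in> range (extend_zero z)"
    by (intro Min_in) auto
  then obtain i0 where "Min (range (extend_zero z)) = extend_zero z i0"
    by (rule rangeE)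
  moreover have "Min (range (extend_zero z)) \<le> extend_zero z j" for j
    by (intro Min_le) auto
  ultimately show ?thesis
    by (intro that[of i0]) simp
qed

text \<open>Keeping only the weight of \<open>i0\<close> in the normalising sum bounds the
  probability by \<open>exp (- l w)\<close>, with \<open>w\<close> the height above
  \<open>i0\<close> and \<open>l = - ln \<beta>\<close>; then
  \<open>l w \<le> exp (l w)\<close>.\<close>

lemma site_prob_mult_height_le:
  assumes "\<beta> < 1" and "extend_zero z i0 \<le> extend_zero (z :: int ^ 'n) i"
  shows "site_prob \<beta> z i * real_of_int (extend_zero z i - extend_zero z i0) \<le> 1 / (- ln \<beta>)"
proof -
  define w where "w = real_of_int (extend_zero z i - extend_zero z i0)"
  define l where "l = - ln \<beta>"
  have l: "l > 0" "w \<ge> 0"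
    using \<beta> assms by (simp_all add: l_def w_def)
  have "\<beta> powi extend_zero z i0 \<le> (\<Sum>j\<in>UNIV. \<beta> powi extend_zero z j)"
    using \<beta> by (intro member_le_sum) auto
  then have "site_prob \<beta> z i \<le> \<beta> powi extend_zero z i / \<beta> powi extend_zero z i0"
    unfolding site_prob_def using \<beta> by (intro divide_left_mono mult_pos_pos weight_sum_pos) auto
  also have "\<dots> = \<beta> powi (extend_zero z i - extend_zero z i0)"
    using \<beta> by (simp add: power_int_diff)
  also have "\<dots> = exp (- (l * w))"
    using \<beta> by (simp add: l_def w_def powr_real_of_int'[symmetric] powr_def mult.commute)
  finally have "site_prob \<beta> z i * w \<le> exp (- (l * w)) * w"
    using l by (intro mult_right_mono) auto
  also have "\<dots> = (l * w) / exp (l * w) / l"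
    using l by (simp add: exp_minus field_simps)
  also have "\<dots> \<le> 1 / l"
  proof (intro divide_right_mono)
    have "l * w \<le> exp (l * w)"
      using exp_ge_add_one_self[of "l * w"] by linarith
    then show "l * w / exp (l * w) \<le> 1"
      by simp
  qed (use l in simp)
  finally show ?thesis
    by (simp add: w_def l_def)
qed

text \<open>Depends on height differences only, so the normalisation of site \<open>None\<close> to
  0 does not affect it. Each unordered pair is counted twice.\<close>

definition spread :: "int ^ 'n \<Rightarrow> real" where
  "spread z = (\<Sum>j\<in>UNIV. \<Sum>k\<in>UNIV. real_of_int (extend_zero z j - extend_zero z k) ^ 2)"

lemma spread_nonneg: "spread z \<ge> 0"
  unfolding spread_def by (intro sum_nonneg) auto

lemma spread_grow_at:
  "spread (grow_at z i) \<le> spread z + 4 * (\<Sum>k\<in>UNIV. real_of_int (extend_zero z i - extend_zero z k)) + 2 * n"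
proof -
  define u where "u j = real_of_int (extend_zero z j)" for j
  define e :: "'n option \<Rightarrow> real" where "e j = (if j = i then 1 else 0)" for j
  have sum_e: "(\<Sum>j\<in>UNIV. e j) = 1" "(\<Sum>j\<in>UNIV. e j * g j) = g i" for g
    unfolding e_def by (simp_all add: if_distrib[of "\<lambda>x. x * _"] cong: if_cong)
  have "spread (grow_at z i) = (\<Sum>j\<in>UNIV. \<Sum>k\<in>UNIV. ((u j - u k) + (e j - e k))\<^sup>2)"
    unfolding spread_def extend_zero_grow_at u_def e_def
    by (intro sum.cong refl arg_cong[where f = "\<lambda>x. x\<^sup>2"]) auto
  \<comment> \<open>The square \<open>(e j - e k)\<^sup>2\<close> is bounded by
    \<open>e j + e k\<close>, which sums to \<open>2 * n\<close>; the two cross terms turn out equal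
    by antisymmetry, whence the factor 4.\<close>
  also have "\<dots> \<le> (\<Sum>j\<in>UNIV. \<Sum>k\<in>UNIV. (u j - u k)\<^sup>2 + 2 * (e j * (u j - u k)) - 2 * (e k * (u j - u k)) + (e j + e k))"
    by (intro sum_mono) (auto simp: e_def power2_eq_square algebra_simps)
  also have "\<dots> = spread z + 2 * (\<Sum>j\<in>UNIV. e j * (\<Sum>k\<in>UNIV. u j - u k))
      - 2 * (\<Sum>j\<in>UNIV. \<Sum>k\<in>UNIV. e k * (u j - u k)) + 2 * n"
    by (simp add: spread_def u_def sum.distrib sum_subtractf sum_distrib_left[symmetric] sum_e n_def)
  also have "\<dots> = spread z + 2 * (\<Sum>k\<in>UNIV. u i - u k) - 2 * (\<Sum>j\<in>UNIV. u j - u i) + 2 * n"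
    by (simp only: sum_e)
  also have "(\<Sum>j\<in>UNIV. u j - u i) = - (\<Sum>k\<in>UNIV. u i - u k)"
    by (simp add: sum_negf[symmetric])
  also have "spread z + 2 * (\<Sum>k\<in>UNIV. u i - u k) - 2 * - (\<Sum>k\<in>UNIV. u i - u k) + 2 * n =
      spread z + 4 * (\<Sum>k\<in>UNIV. u i - u k) + 2 * n"
    by simp
  finally show ?thesis
    by (simp add: u_def)
qed

text \<open>In heights \<open>w\<close> above the lowest site with total \<open>W\<close>, growth at
  \<open>i\<close> contributes \<open>4 * (n * w i - W)\<close>. The mean of \<open>w i\<close> is
  bounded uniformly in \<open>z\<close>, so \<open>- 4 * W\<close> wins far out.\<close>

lemma spread_drift:
  assumes "\<beta> < 1" and i0: "\<And>j. extend_zero z i0 \<le> extend_zero z j"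
  shows "(\<Sum>i\<in>UNIV. site_prob \<beta> z i * spread (grow_at z i)) \<le>
    spread z + 4 * n\<^sup>2 * (1 / (- ln \<beta>)) - 4 * (\<Sum>k\<in>UNIV. real_of_int (extend_zero z k - extend_zero z i0)) + 2 * n"
proof -
  define w where "w j = real_of_int (extend_zero z j - extend_zero z i0)" for j
  define W where "W = (\<Sum>j\<in>UNIV. w j)"
  let ?p = "site_prob \<beta> z"
  have "(\<Sum>i\<in>UNIV. ?p i * w i) \<le> (\<Sum>i\<in>(UNIV :: 'n option set). 1 / (- ln \<beta>))"
    unfolding w_def using assms by (intro sum_mono site_prob_mult_height_le) auto
  then have mean: "(\<Sum>i\<in>UNIV. ?p i * w i) \<le> n * (1 / (- ln \<beta>))"
    by (simp add: n_def)
  have "(\<Sum>i\<in>UNIV. ?p i * spread (grow_at z i)) \<le> (\<Sum>i\<in>UNIV. ?p i * (spread z + 4 * (n * w i - W) + 2 * n))"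
  proof (intro sum_mono mult_left_mono)
    fix i
    have "(\<Sum>k\<in>UNIV. real_of_int (extend_zero z i - extend_zero z k)) = (\<Sum>k\<in>UNIV. w i - w k)"
      by (simp add: w_def)
    also have "\<dots> = n * w i - W"
      by (simp add: sum_subtractf W_def n_def)
    finally show "spread (grow_at z i) \<le> spread z + 4 * (n * w i - W) + 2 * n"
      using spread_grow_at[of z i] by simp
    show "0 \<le> ?p i"
      using site_prob_pos[of z i] by simp
  qed
  also have "\<dots> = (\<Sum>i\<in>UNIV. ?p i * (spread z - 4 * W + 2 * n) + 4 * n * (?p i * w i))"
    by (intro sum.cong) (auto simp: algebra_simps)
  also have "\<dots> = spread z - 4 * W + 2 * n + 4 * n * (\<Sum>i\<in>UNIV. ?p i * w i)"
    by (simp only: sum.distrib sum_distrib_right[symmetric] sum_distrib_left[symmetric] sum_site_prob mult_1)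
  also have "\<dots> \<le> spread z - 4 * W + 2 * n + 4 * n * (n * (1 / (- ln \<beta>)))"
    using mean by (intro add_left_mono mult_left_mono) (auto simp: n_def)
  finally show ?thesis
    by (simp add: W_def w_def power2_eq_square algebra_simps)
qed

lemma positive_recurrent_difference_kernel:
  assumes "\<beta> < 1"
  shows "positive_recurrent_state K z"
proof -
  define C where "C = 1 / (- ln \<beta>)"
  have C: "C \<ge> 0"
    using \<beta> assms by (simp add: C_def)
  have "n \<ge> 0"
    by (simp add: n_def)
  \<comment> \<open>Chosen so that \<open>W > R\<close> forces
    \<open>4 * n\<^sup>2 * C - 4 * W + 2 * n + 1 \<le> 0\<close>.\<close>
  define R where "R = n\<^sup>2 * C + n + 1"
  define F where "F = {z :: int ^ 'n. \<forall>j k. \<bar>real_of_int (extend_zero z j - extend_zero z k)\<bar> \<le> R}"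
  show ?thesis
  proof (rule foster_positive_recurrent)
    \<comment> \<open>Site \<open>None\<close> has height 0, so bounded pairwise differences bound
      every coordinate.\<close>
    have "F \<subseteq> {z. \<forall>k. z $ k \<in> {-\<lceil>R\<rceil>..\<lceil>R\<rceil>}}"
    proof safe
      fix x :: "int ^ 'n" and k
      assume "x \<in> F"
      then have "\<bar>real_of_int (extend_zero x (Some k) - extend_zero x None)\<bar> \<le> R"
        unfolding F_def by blast
      then have "\<bar>real_of_int (x $ k)\<bar> \<le> R"
        by (simp add: extend_zero_def)
      then show "x $ k \<in> {-\<lceil>R\<rceil>..\<lceil>R\<rceil>}"
        by simp linarith
    qed
    then show "finite F"
      using finite_int_vec_box by (rule finite_subset)
    \<comment> \<open>The constant on \<open>F\<close> is the drift bound plus 1 with the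
      nonpositive term \<open>- 4 * W\<close> dropped.\<close>
    show "ennreal (4 * n\<^sup>2 * C + 2 * n + 1) \<noteq> \<top>" "ennreal (spread x) \<noteq> \<top>" for x
      by auto
    show "\<exists>m. avoid K z m x < 1" for x
      by (rule hits_in_finite_time)
    fix x :: "int ^ 'n"
    obtain i0 where i0: "\<And>j. extend_zero x i0 \<le> extend_zero x j"
      by (rule argmin_site[where z = x]) blast
    define W where "W = (\<Sum>k\<in>UNIV. real_of_int (extend_zero x k - extend_zero x i0))"
    have le_W: "real_of_int (extend_zero x j - extend_zero x i0) \<le> W" for j
      unfolding W_def using i0 by (intro member_le_sum) auto
    have W: "W \<ge> 0"
      unfolding W_def using i0 by (intro sum_nonneg) auto
    have "(\<Sum>i\<in>UNIV. site_prob \<beta> x i * spread (grow_at x i)) + 1 \<le>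
        spread x + (if x \<in> F then 4 * n\<^sup>2 * C + 2 * n + 1 else 0)"
    proof (cases "x \<in> F")
      case True
      then show ?thesis
        using spread_drift[OF assms i0] W unfolding W_def[symmetric] C_def[symmetric] by simp
    next
      case False
      then obtain j k where "\<bar>real_of_int (extend_zero x j - extend_zero x k)\<bar> > R"
        by (auto simp: F_def not_le)
      \<comment> \<open>Heights above the lowest site lie between 0 and \<open>W\<close>, hence so
        do their absolute differences.\<close>
      then have "W > R"
        using le_W[of j] le_W[of k] i0[of j] i0[of k] by (auto simp: abs_if split: if_splits)
      then have "4 * n\<^sup>2 * C - 4 * W + 2 * n + 1 \<le> 0"
        using \<open>n \<ge> 0\<close> unfolding R_def mult.assoc by linarith
      then show ?thesis
        using False spread_drift[OF assms i0] unfolding W_def[symmetric] C_def[symmetric] by simp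
    qed
    then have "ennreal ((\<Sum>i\<in>UNIV. site_prob \<beta> x i * spread (grow_at x i)) + 1) \<le>
        ennreal (spread x + (if x \<in> F then 4 * n\<^sup>2 * C + 2 * n + 1 else 0))"
      by (rule ennreal_leI)
    moreover have "ennreal ((\<Sum>i\<in>UNIV. site_prob \<beta> x i * spread (grow_at x i)) + 1) = (\<integral>\<^sup>+ y. ennreal (spread y) \<partial>K x) + 1"
    proof -
      have nonneg: "0 \<le> site_prob \<beta> x i * spread (grow_at x i)" for i
        using site_prob_pos[of x i] spread_nonneg by simp
      have "ennreal ((\<Sum>i\<in>UNIV. site_prob \<beta> x i * spread (grow_at x i)) + 1) =
          ennreal (\<Sum>i\<in>UNIV. site_prob \<beta> x i * spread (grow_at x i)) + 1"
        using nonneg by (subst ennreal_plus) (auto intro: sum_nonneg)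
      also have "ennreal (\<Sum>i\<in>UNIV. site_prob \<beta> x i * spread (grow_at x i)) =
          (\<Sum>i\<in>UNIV. ennreal (site_prob \<beta> x i * spread (grow_at x i)))"
        using nonneg by (simp add: sum_ennreal)
      finally show ?thesis
        unfolding nn_integral_difference_kernel
        using site_prob_pos[of x] spread_nonneg by (simp add: ennreal_mult less_imp_le)
    qed
    moreover have "ennreal (spread x + (if x \<in> F then 4 * n\<^sup>2 * C + 2 * n + 1 else 0)) =
        ennreal (spread x) + (if x \<in> F then ennreal (4 * n\<^sup>2 * C + 2 * n + 1) else 0)"
      using spread_nonneg[of x] C \<open>n \<ge> 0\<close> by (auto intro!: ennreal_plus)
    ultimately show "(\<integral>\<^sup>+ y. ennreal (spread y) \<partial>K x) + 1 \<le>
        ennreal (spread x) + (if x \<in> F then ennreal (4 * n\<^sup>2 * C + 2 * n + 1) else 0)"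
      by simp
  qed
qed

section \<open>Escape with positive probability for \<beta> > 1\<close>

text \<open>With a lead of \<open>m\<close>, every other weight is at most
  \<open>(1 / \<beta>) ^ m\<close> times that of \<open>i\<close>; then
  \<open>1 + x \<le> exp x\<close>. The exponential form turns products along a path into
  sums.\<close>

lemma site_prob_ge:
  assumes "\<And>j. j \<noteq> i \<Longrightarrow> extend_zero z j + int m \<le> extend_zero (z :: int ^ 'n) i" and "\<beta> > 1"
  shows "site_prob \<beta> z i \<ge> exp (- (n * (1 / \<beta>) ^ m))"
proof -
  let ?u = "extend_zero z"
  have "(\<Sum>j\<in>UNIV. \<beta> powi ?u j) = \<beta> powi ?u i + (\<Sum>j\<in>UNIV - {i}. \<beta> powi ?u j)"
    by (intro sum.remove) auto
  also have "(\<Sum>j\<in>UNIV - {i}. \<beta> powi ?u j) \<le> (\<Sum>j\<in>UNIV - {i}. \<beta> powi ?u i * (1 / \<beta>) ^ m)"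
  proof (rule sum_mono)
    fix j assume "j \<in> UNIV - {i}"
    then have "\<beta> powi ?u j \<le> \<beta> powi (?u i - int m)"
      using assms by (intro power_int_increasing) (auto simp: algebra_simps)
    also have "\<dots> = \<beta> powi ?u i * (1 / \<beta>) ^ m"
      using \<beta> by (simp add: power_int_diff power_one_over field_simps)
    finally show "\<beta> powi ?u j \<le> \<beta> powi ?u i * (1 / \<beta>) ^ m" .
  qed
  also have "\<dots> \<le> (\<Sum>j\<in>(UNIV :: 'n option set). \<beta> powi ?u i * (1 / \<beta>) ^ m)"
    using \<beta> by (intro sum_mono2) auto
  finally have sum: "(\<Sum>j\<in>UNIV. \<beta> powi ?u j) \<le> \<beta> powi ?u i * (1 + n * (1 / \<beta>) ^ m)"
    by (simp add: n_def algebra_simps)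
  also have "\<dots> \<le> \<beta> powi ?u i * exp (n * (1 / \<beta>) ^ m)"
    using \<beta> by (intro mult_left_mono exp_ge_add_one_self) auto
  finally show ?thesis
    unfolding site_prob_def using weight_sum_pos[of z] by (simp add: exp_minus field_simps)
qed

text \<open>The path on which a highest site \<open>i\<close> grows at every step avoids
  \<open>z\<close>; its probabilities multiply to the exponential of a geometric sum, bounded
  uniformly in \<open>l\<close>.\<close>

lemma avoid_lower_bound:
  assumes "\<beta> > 1"
  shows "ennreal (exp (- (n * (1 / (1 - 1 / \<beta>))))) \<le> avoid K z l z"
proof -
  obtain i where i: "\<And>j. extend_zero z j \<le> extend_zero z i"
  proof -
    have "Max (range (extend_zero z)) \<in> range (extend_zero z)"
      by (intro Max_in) auto
    then obtain i where "Max (range (extend_zero z)) = extend_zero z i"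
      by (rule rangeE)
    moreover have "extend_zero z j \<le> Max (range (extend_zero z))" for j
      by (intro Max_ge) auto
    ultimately show ?thesis
      by (intro that[of i]) simp
  qed
  define y where "y m = ((\<lambda>x. grow_at x i) ^^ m) z" for m
  have y_Suc: "y (Suc m) = grow_at (y m) i" for m
    by (simp add: y_def)
  have y: "extend_zero (y m) j = extend_zero z j + (if j = i then int m else 0) - (if i = None then int m else 0)" for m j
  proof (induction m)
    case (Suc m)
    then show ?case
      by (auto simp: y_Suc extend_zero_grow_at)
  qed (simp add: y_def)
  \<comment> \<open>The height of \<open>i\<close> relative to any other site has strictly
    increased; a second site always exists.\<close>
  have y_neq: "y (Suc m) \<noteq> z" for m
  proof
    assume "y (Suc m) = z"
    moreover obtain j :: "'n option" where "j \<noteq> i"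
      by (metis option.distinct(1))
    ultimately show False
      using y[of "Suc m" i] y[of "Suc m" j] by simp
  qed
  \<comment> \<open>The start is generalised to \<open>y m\<close>, since the available bound
    depends on the lead \<open>m\<close> already gained.\<close>
  have "ennreal (exp (- (n * (\<Sum>k=m..<m + l. (1 / \<beta>) ^ k)))) \<le> avoid K z l (y m)" for m
  proof (induction l arbitrary: m)
    case (Suc l)
    have "(\<Sum>k=m..<m + Suc l. (1 / \<beta>) ^ k) = (1 / \<beta>) ^ m + (\<Sum>k=Suc m..<Suc m + l. (1 / \<beta>) ^ k)"
      by (subst sum.atLeast_Suc_lessThan) auto
    then have "ennreal (exp (- (n * (\<Sum>k=m..<m + Suc l. (1 / \<beta>) ^ k)))) =
        ennreal (exp (- (n * (1 / \<beta>) ^ m))) * ennreal (exp (- (n * (\<Sum>k=Suc m..<Suc m + l. (1 / \<beta>) ^ k))))"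
      by (simp add: ennreal_mult[symmetric] exp_add[symmetric] distrib_left)
    also have "\<dots> \<le> ennreal (site_prob \<beta> (y m) i) * avoid K z l (y (Suc m))"
      using i assms by (intro mult_mono Suc.IH ennreal_leI site_prob_ge) (auto simp: y)
    also have "\<dots> = ennreal (site_prob \<beta> (y m) i) * (if grow_at (y m) i = z then 0 else avoid K z l (grow_at (y m) i))"
      using y_neq[of m] by (simp add: y_Suc)
    also have "\<dots> \<le> avoid K z (Suc l) (y m)"
      unfolding funpow.simps comp_apply taboo_def nn_integral_difference_kernel
      by (intro member_le_sum) auto
    finally show ?case .
  qed simp
  from this[of 0] have "ennreal (exp (- (n * (\<Sum>k<l. (1 / \<beta>) ^ k)))) \<le> avoid K z l z"
    by (simp add: y_def atLeast0LessThan)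
  moreover have "(\<Sum>k<l. (1 / \<beta>) ^ k) \<le> 1 / (1 - 1 / \<beta>)"
  proof -
    have "(\<Sum>k<l. (1 / \<beta>) ^ k) \<le> (\<Sum>k. (1 / \<beta>) ^ k)"
      using assms by (intro sum_le_suminf summable_geometric) auto
    also have "\<dots> = 1 / (1 - 1 / \<beta>)"
      using assms by (intro suminf_geometric) auto
    finally show ?thesis .
  qed
  then have "n * (\<Sum>k<l. (1 / \<beta>) ^ k) \<le> n * (1 / (1 - 1 / \<beta>))"
    by (intro mult_left_mono) (auto simp: n_def)
  then have "ennreal (exp (- (n * (1 / (1 - 1 / \<beta>))))) \<le> ennreal (exp (- (n * (\<Sum>k<l. (1 / \<beta>) ^ k))))"
    by (intro ennreal_leI) simp
  ultimately show ?thesis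
    by (rule order.trans[rotated])
qed

end

lemma choose_site_scale:
  "c \<noteq> 0 \<Longrightarrow> choose_site (\<lambda>i. c * w i) = choose_site w"
  unfolding choose_site_def by (simp flip: sum_distrib_left)

text \<open>With singleton neighbourhoods all weights share the factor
  \<open>\<beta> ^ (x $ None)\<close>, which cancels in the normalisation; the choice of site
  depends on the differences alone.\<close>

lemma map_pmf_growth_kernel:
  fixes x :: "nat ^ 'n::finite option"
  assumes "\<beta> > 0"
  defines "D \<equiv> \<lambda>x :: nat ^ 'n option. \<chi> i. int (x $ Some i) - int (x $ None)"
  shows "map_pmf D (growth_kernel \<beta> (\<lambda>i. {i}) x) = difference_kernel \<beta> (\<lambda>i. {i}) (D x)"
proof -
  have D: "D (x + axis i 1) = grow_at (D x) i" for i
    by (cases i) (auto simp: D_def grow_at_def vec_eq_iff axis_def)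
  have "\<beta> ^ (x $ i) = \<beta> ^ (x $ None) * \<beta> powi extend_zero (D x) i" for i
  proof -
    have "int (x $ i) = int (x $ None) + extend_zero (D x) i"
      by (cases i) (auto simp: D_def extend_zero_def)
    then show ?thesis
      using power_int_add[of \<beta> "int (x $ None)" "extend_zero (D x) i"] assms(1)
      by (metis less_irrefl power_int_of_nat)
  qed
  then have "(\<lambda>i. \<beta> ^ (x $ i)) = (\<lambda>i. \<beta> ^ (x $ None) * \<beta> powi extend_zero (D x) i)"
    by (rule ext)
  then have "choose_site (\<lambda>i. \<beta> ^ (x $ i)) = choose_site (\<lambda>i. \<beta> powi extend_zero (D x) i)"
    using choose_site_scale[of "\<beta> ^ (x $ None)" "\<lambda>i. \<beta> powi extend_zero (D x) i"] assms(1)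
    by (simp only: power_not_zero less_imp_neq[symmetric] not_False_eq_True)
  then show ?thesis
    unfolding growth_kernel_def difference_kernel_def grow_at_def[symmetric]
    by (simp add: pmf.map_comp o_def D del: One_nat_def)
qed

theorem theorem1:
  fixes \<beta> :: real
    and M :: "'w measure"
    and \<xi> :: "nat \<Rightarrow> 'w \<Rightarrow> nat ^ ('n::finite) option"
    and U :: "'n option \<Rightarrow> 'n option set"
  assumes "CARD('n) \<ge> 2"
    and "\<beta> > 0"
    and "U = (\<lambda>i. {i})"
    and "growth_process \<beta> U M \<xi>"
  shows "(\<beta> < 1 \<longrightarrow> ergodic_chain M (difference_kernel \<beta> U) (differences \<xi>)) \<and>
         (\<beta> > 1 \<longrightarrow> transient_chain M (difference_kernel \<beta> U) (differences \<xi>))"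
proof (intro conjI impI)
  have mc: "markov_chain M (difference_kernel \<beta> U) (differences \<xi>)"
    using markov_chain_lump[OF assms(4)[unfolded growth_process_def], where K' = "difference_kernel \<beta> U"]
      map_pmf_growth_kernel[OF assms(2)]
    unfolding assms(3) differences_def[abs_def] by blast
  show "ergodic_chain M (difference_kernel \<beta> U) (differences \<xi>)" if "\<beta> < 1"
    using mc unfolding ergodic_chain_def assms(3)
    by (intro conjI allI positive_recurrent_difference_kernel[OF assms(2) that])
  show "transient_chain M (difference_kernel \<beta> U) (differences \<xi>)" if "\<beta> > 1"
    unfolding transient_chain_def
  proof
    have "AE \<omega> in M. \<forall>\<^sub>F t in sequentially. differences \<xi> t \<omega> \<noteq> z" for z
      using avoid_lower_bound[OF assms(2) that]
      by (intro markov_chain_eventually_leaves[OF mc exp_gt_zero]) (simp add: assms(3))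
    \<comment> \<open>There are only countably many states, so one null set serves them all.\<close>
    then have "AE \<omega> in M. \<forall>z. \<forall>\<^sub>F t in sequentially. differences \<xi> t \<omega> \<noteq> z"
      by (simp add: AE_all_countable)
    then show "AE \<omega> in M. filterlim (\<lambda>t. norm (\<chi> i. real_of_int (differences \<xi> t \<omega> $ i))) at_top sequentially"
      by (auto elim!: AE_mp intro!: filterlim_norm_int_vec)
  qed (rule mc)
qed

end
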